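(* Let $A\in\mathbb{R}^{n\times n}$, $B\in\mathbb{R}^{n\times m}$ with $(A,B)$ controllable, and let $\lambda>0$, $\gamma\neq 0$, $T>0$, $N\in\mathbb{N}$, $N\ge 1$, $T_{\mathrm s}=T/N$. Let $(u(t),x(t))$, $t\in[0,T]$, be an input-state trajectory of $\dot x=Ax+Bu$, and let $U\in\mathbb{R}^{m\times N}$, $Z,\dot Z\in\mathbb{R}^{(n+m)\times N}$, $E\in\mathbb{R}^{n\times N}$ be the data batches built from it as described in the context. Consider the following linear matrix inequality (LMI) in the unknown $Q\in\mathbb{R}^{N\times(n+m)}$: $$\left(\dot Z-\begin{bmatrix}\gamma I_n \\ 0\end{bmatrix}E\right)Q+Q^\top\left(\dot Z-\begin{bmatrix}\gamma I_n \\ 0\end{bmatrix}E\right)^\top\prec 0,\qquad ZQ=Q^\top Z^\top\succ 0. \quad (\ast)$$ Then: 1. The LMI $(\ast)$ is feasible (i.e. has a solution $Q$) if the data batch is exciting, i.e. if $$\operatorname{rank}\begin{bmatrix}Z \\ U\end{bmatrix}=n+2m.$$ 2. For any solution $Q$ of $(\ast)$, the gain $K=UQ(ZQ)^{-1}\in\mathbb{R}^{m\times(n+m)}$ is such that $F+GK$ is Hurwitz, where $$F=\begin{bmatrix}A&B \\ 0&-\lambda I_m\end{bmatrix},\qquad G=\begin{bmatrix}0 \\ \gamma I_m\end{bmatrix}.$$ As a consequence, the origin $(x,\hat\zeta_{\mathrm c})=0$ of the closed-loop interconnection of the plant $\dot x=Ax+Bu$ with the controller $$\dot{\hat\zeta}_{\mathrm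 c}=-\lambda\hat\zeta_{\mathrm c}+\gamma\begin{bmatrix}x \\ u\end{bmatrix},\qquad u=K\hat\zeta_{\mathrm c},\qquad \hat\zeta_{\mathrm c}\in\mathbb{R}^{n+m},$$ is globally exponentially stable.
   Context: Construction of the data batches. Given an input signal $u:[0,T]\to\mathbb{R}^m$ and the corresponding solution $x:[0,T]\to\mathbb{R}^n$ of $\dot x=Ax+Bu$ (any initial condition $x(0)$), let $\hat\zeta:[0,T]\to\mathbb{R}^{n+m}$ be the solution of the filter $$\dot{\hat\zeta}(t)=-\lambda\hat\zeta(t)+\gamma\begin{bmatrix}x(t) \\ u(t)\end{bmatrix},\qquad \hat\zeta(0)=0,$$ where $\dot{\hat\zeta}(t)$ at a sampling instant denotes the value of the right-hand side at that time. The batches are $$U=\begin{bmatrix}u(0)&u(T_{\mathrm s})&\cdots&u((N-1)T_{\mathrm s})\end{bmatrix},\quad Z=\begin{bmatrix}\hat\zeta(0)&\hat\zeta(T_{\mathrm s})&\cdots&\hat\zeta((N-1)T_{\mathrm s})\end{bmatrix},$$ $$\dot Z=\begin{bmatrix}\dot{\hat\zeta}(0)&\dot{\hat\zeta}(T_{\mathrm s})&\cdots&\dot{\hat\zeta}((N-1)T_{\mathrm s})\end{bmatrix},\quad E=\begin{bmatrix}x(0)&e^{-\lambda T_{\mathrm s}}x(0)&\cdots&e^{-\lambda(N-1)T_{\mathrm s}}x(0)\end{bmatrix}.$$ Notation: for a symmetric matrix $M$, $M\succ0$ (resp. $M\prec0$) means positive (resp. negative) definite; the condition $ZQ=Q^\top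 Z^\top\succ0$ means $ZQ$ is symmetric and positive definite. A matrix is Hurwitz if all its eigenvalues have negative real part. *)

theory Defs
  imports "HOL-Analysis.Analysis"
begin

text \<open>A matrix is a vector of rows, so this stacks both column vectors and matrices
  (with equally many columns).\<close>

definition stack :: "'a ^ 'p \<Rightarrow> 'a ^ 'q \<Rightarrow> 'a ^ ('p + 'q)" where
  "stack M L = (\<chi> i. case i of Inl a \<Rightarrow> M $ a | Inr b \<Rightarrow> L $ b)"

definition beside :: "'a ^ 'p ^ 'r \<Rightarrow> 'a ^ 'q ^ 'r \<Rightarrow> 'a ^ ('p + 'q) ^ 'r" where
  "beside M L = (\<chi> i. stack (M $ i) (L $ i))"

definition pos_def :: "real ^ 'p ^ 'p \<Rightarrow> bool" where
  "pos_def M \<longleftrightarrow> transpose M = M \<and> (\<forall>v. v \<noteq> 0 \<longrightarrow> 0 < v \<bullet> (M *v v))"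

definition neg_def :: "real ^ 'p ^ 'p \<Rightarrow> bool" where
  "neg_def M \<longleftrightarrow> transpose M = M \<and> (\<forall>v. v \<noteq> 0 \<longrightarrow> v \<bullet> (M *v v) < 0)"

definition complex_eigenvalue :: "real ^ 'p ^ 'p \<Rightarrow> complex \<Rightarrow> bool" where
  "complex_eigenvalue M l \<longleftrightarrow>
    (\<exists>v :: complex ^ 'p. v \<noteq> 0 \<and> (\<chi> i j. complex_of_real (M $ i $ j)) *v v = l *s v)"

definition hurwitz :: "real ^ 'p ^ 'p \<Rightarrow> bool" where
  "hurwitz M \<longleftrightarrow> (\<forall>l. complex_eigenvalue M l \<longrightarrow> Re l < 0)"

text \<open>Inputs are only required to be integrable, so solutions are understood in the sense of
  Caratheodory: absolutely continuous functions satisfying the integrated equation. For a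
  right-hand side that is continuous in time and state these are the classical solutions.\<close>

definition caratheodory_solution ::
    "(real \<Rightarrow> 'v \<Rightarrow> 'v) \<Rightarrow> real \<Rightarrow> (real \<Rightarrow> 'v :: euclidean_space) \<Rightarrow> bool" where
  "caratheodory_solution f \<tau> x \<longleftrightarrow>
    (\<lambda>s. f s (x s)) absolutely_integrable_on {0..\<tau>} \<and>
    (\<forall>t\<in>{0..\<tau>}. x t = x 0 + integral {0..t} (\<lambda>s. f s (x s)))"

definition input_state_trajectory ::
    "real ^ 'n ^ 'n \<Rightarrow> real ^ 'm ^ 'n \<Rightarrow> real \<Rightarrow> (real \<Rightarrow> real ^ 'm) \<Rightarrow> (real \<Rightarrow> real ^ 'n) \<Rightarrow> bool" where
  "input_state_trajectory A B \<tau> u x \<longleftrightarrow>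
    u absolutely_integrable_on {0..\<tau>} \<and>
    caratheodory_solution (\<lambda>t y. A *v y + B *v u t) \<tau> x"

definition controllable :: "real ^ 'n ^ 'n \<Rightarrow> real ^ 'm ^ 'n \<Rightarrow> bool" where
  "controllable A B \<longleftrightarrow>
    (\<forall>x0 x1. \<exists>\<tau> u x. 0 < \<tau> \<and> input_state_trajectory A B \<tau> u x \<and> x 0 = x0 \<and> x \<tau> = x1)"

definition filter_rhs ::
    "real \<Rightarrow> real \<Rightarrow> real ^ 'n \<Rightarrow> real ^ 'm \<Rightarrow> real ^ ('n + 'm) \<Rightarrow> real ^ ('n + 'm)" where
  "filter_rhs lam gam x u z = - lam *\<^sub>R z + gam *\<^sub>R stack x u"

text \<open>The columns are indexed by a finite linearly ordered type; the column in position
  \<open>k = 0, \<dots>, N - 1\<close> (the number of smaller indices) is \<open>f (k * Ts)\<close>.\<close>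

definition samples :: "real \<Rightarrow> (real \<Rightarrow> real ^ 'p) \<Rightarrow> real ^ ('k :: {finite, linorder}) ^ 'p" where
  "samples Ts f = (\<chi> i j. f (real (card {..<j}) * Ts) $ i)"

definition lmi_solution ::
    "real \<Rightarrow> real ^ 'k ^ ('n :: finite + 'm :: finite) \<Rightarrow> real ^ 'k ^ ('n + 'm) \<Rightarrow> real ^ 'k ^ 'n \<Rightarrow>
     real ^ ('n + 'm) ^ 'k \<Rightarrow> bool" where
  "lmi_solution gam Z Zdot E Q \<longleftrightarrow>
    (let D = Zdot - stack (mat gam) 0 ** E
     in neg_def (D ** Q + transpose Q ** transpose D)) \<and>
    Z ** Q = transpose Q ** transpose Z \<and> pos_def (Z ** Q)"

definition closed_loop ::
    "real ^ 'n ^ 'n \<Rightarrow> real ^ 'm ^ 'n \<Rightarrow> real \<Rightarrow> real \<Rightarrow> real ^ ('n + 'm) ^ 'm \<Rightarrow>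
     (real ^ 'n) \<times> (real ^ ('n + 'm)) \<Rightarrow> (real ^ 'n) \<times> (real ^ ('n + 'm))" where
  "closed_loop A B lam gam K = (\<lambda>(x, z).
    let u = K *v z in (A *v x + B *v u, filter_rhs lam gam x u z))"

text \<open>The bound is required of solutions on every interval \<open>[0, \<tau>]\<close>, not only of those existing
  for all times, so that finite escape is excluded as well.\<close>

definition origin_globally_exponentially_stable ::
    "('v \<Rightarrow> 'v :: euclidean_space) \<Rightarrow> bool" where
  "origin_globally_exponentially_stable f \<longleftrightarrow> f 0 = 0 \<and>
    (\<exists>c > 0. \<exists>\<alpha> > 0. \<forall>\<tau> > 0. \<forall>x. caratheodory_solution (\<lambda>_. f) \<tau> x \<longrightarrow>
      (\<forall>t\<in>{0..\<tau>}. norm (x t) \<le> c * exp (- \<alpha> * t) * norm (x 0)))"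

end

theory Submission
  imports Defs
begin

text \<open>Up to the decaying term \<open>\<gamma> e\<^sup>-\<^sup>\<lambda>\<^sup>t x(0)\<close>, which the correction by \<open>E\<close> removes, the filter
  state obeys \<open>\<zeta>' = F \<zeta> + G u\<close>, so the data matrix in the LMI equals \<open>F Z + G U\<close>. For a solution
  \<open>Q\<close> with \<open>P = Z Q\<close> the LMI is then the Lyapunov inequality for \<open>F + G K\<close>, and adding a large
  multiple of the squared decaying term gives a quadratic Lyapunov function of the closed loop.
  Conversely, full row rank makes \<open>Z Q\<close> and \<open>U Q\<close> arbitrary, so feasibility only asks for
  \<open>P \<succ> 0\<close> and \<open>Y\<close> with \<open>F P + G Y + (F P + G Y)\<^sup>T \<prec> 0\<close>. If there were none, convex separation
  would produce a nonzero positive semidefinite form on the plant states that no input can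
  decrease, contradicting controllability.\<close>

section \<open>Block matrices and rank-one matrices\<close>

lemma stack_component [simp]:
  "stack M L $ Inl i = M $ i" "stack M L $ Inr j = L $ j"
  by (simp_all add: stack_def)

lemma stack_cases:
  obtains a b where "v = stack a b"
proof
  show "v = stack (\<chi> i. v $ Inl i) (\<chi> i. v $ Inr i)"
    by (simp add: vec_eq_iff stack_def split: sum.split)
qed

lemma stack_eq_iff [simp]: "stack a b = stack c d \<longleftrightarrow> a = c \<and> b = d"
  by (metis stack_component vec_eq_iff)

lemma stack_algebra:
  fixes a :: "'a::real_vector ^ 'p" and b :: "'a ^ 'q"
  shows "stack a b + stack c d = stack (a + c) (b + d)"
    and "stack a b - stack c d = stack (a - c) (b - d)"
    and "r *\<^sub>R stack a b = stack (r *\<^sub>R a) (r *\<^sub>R b)"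
    and "stack 0 0 = (0 :: 'a ^ ('p + 'q))"
  by (simp_all add: vec_eq_iff stack_def split: sum.split)

lemma sum_UNIV_Plus:
  fixes f :: "'p::finite + 'q::finite \<Rightarrow> 'a::comm_monoid_add"
  shows "sum f UNIV = (\<Sum>i\<in>UNIV. f (Inl i)) + (\<Sum>j\<in>UNIV. f (Inr j))"
  unfolding UNIV_Plus_UNIV[symmetric] by (subst sum.Plus) auto

lemma stack_matrix_mult: "stack M L ** Q = stack (M ** Q) (L ** Q)"
  by (simp add: vec_eq_iff stack_def matrix_matrix_mult_def split: sum.split)

lemma stack_matrix_vector_mult: "stack M L *v w = stack (M *v w) (L *v w)"
  by (simp add: vec_eq_iff stack_def matrix_vector_mult_def split: sum.split)

lemma beside_matrix_vector_mult: "beside M L *v stack a b = M *v a + L *v b"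
  by (simp add: vec_eq_iff beside_def matrix_vector_mult_def sum_UNIV_Plus)

lemma mat_matrix_vector_mult: "mat r *v (v :: real ^ 'p) = r *\<^sub>R v"
  by (simp add: vec_eq_iff mat_def matrix_vector_mult_def if_distrib if_distribR sum.delta' cong: if_cong)

lemma scaleR_matrix_mult:
  fixes M :: "real ^ 'q ^ 'p" and L :: "real ^ 'r ^ 'q"
  shows "M ** (r *\<^sub>R L) = r *\<^sub>R (M ** L)"
  by (simp add: vec_eq_iff matrix_matrix_mult_def sum_distrib_left mult_ac)

lemma transpose_add: "transpose (M + L) = transpose M + transpose (L :: real ^ 'p ^ 'q)"
  by (simp add: vec_eq_iff transpose_def)

lemma transpose_scaleR: "transpose (r *\<^sub>R M) = r *\<^sub>R transpose (M :: real ^ 'p ^ 'q)"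
  by (simp add: vec_eq_iff transpose_def)

text \<open>The rank-one matrix a b^T. Pairing a matrix with it yields a bilinear form, so such
  matrices serve as probes for the separating functional in \<open>LMI_alternative\<close>.\<close>

definition outer :: "real ^ 'p \<Rightarrow> real ^ 'q \<Rightarrow> real ^ 'q ^ 'p" where
  "outer a b = (\<chi> i j. a $ i * b $ j)"

lemma inner_outer: "M \<bullet> outer a b = a \<bullet> (M *v b)"
  by (simp add: outer_def inner_vec_def matrix_vector_mult_def sum_distrib_left mult_ac)

lemma matrix_mult_outer: "M ** outer a b = outer (M *v a) b"
  by (simp add: vec_eq_iff outer_def matrix_matrix_mult_def matrix_vector_mult_def sum_distrib_left mult_ac)

lemma transpose_outer: "transpose (outer a b) = outer b a"
  by (simp add: vec_eq_iff outer_def transpose_def)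

lemma outer_matrix_vector_mult: "outer a b *v v = (b \<bullet> v) *\<^sub>R a"
  by (simp add: vec_eq_iff outer_def matrix_vector_mult_def inner_vec_def sum_distrib_left mult_ac)

lemma continuous_on_matrix_vector_mult:
  fixes M :: "real ^ 'q ^ 'p"
  assumes "continuous_on T f"
  shows "continuous_on T (\<lambda>x. M *v f x)"
  by (rule bounded_linear.continuous_on[OF matrix_vector_mul_bounded_linear assms])

lemma matrix_add_rdistrib: "(M + L) ** Q = M ** Q + L ** (Q :: real ^ 'q ^ 'p)"
  by (simp add: vec_eq_iff matrix_matrix_mult_def distrib_right sum.distrib)

lemma inner_transpose_matrix:
  fixes M :: "real ^ 'p ^ 'q"
  shows "a \<bullet> (transpose M *v b) = b \<bullet> (M *v a)"
  by (metis dot_lmul_matrix inner_commute transpose_matrix_vector)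

lemma inner_symmetric_matrix:
  fixes M :: "real ^ 'p ^ 'p"
  assumes "transpose M = M"
  shows "a \<bullet> (M *v b) = b \<bullet> (M *v a)"
  using inner_transpose_matrix[of a M b] assms by simp

section \<open>Caratheodory solutions\<close>

lemma caratheodory_solution_integral:
  assumes "caratheodory_solution f \<tau> x" "t \<in> {0..\<tau>}"
  shows "(\<lambda>s. f s (x s)) integrable_on {0..t}"
    and "x t = x 0 + integral {0..t} (\<lambda>s. f s (x s))"
proof -
  have "(\<lambda>s. f s (x s)) integrable_on {0..\<tau>}"
    using assms set_lebesgue_integral_eq_integral(1) unfolding caratheodory_solution_def by blast
  then show "(\<lambda>s. f s (x s)) integrable_on {0..t}"
    by (rule integrable_on_subinterval) (use assms(2) in auto)
  show "x t = x 0 + integral {0..t} (\<lambda>s. f s (x s))"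
    using assms unfolding caratheodory_solution_def by blast
qed

lemma caratheodory_solution_continuous:
  assumes "caratheodory_solution f \<tau> x"
  shows "continuous_on {0..\<tau>} x"
proof (cases "0 \<le> \<tau>")
  case True
  then have "\<tau> \<in> {0..\<tau>}"
    by simp
  from caratheodory_solution_integral(1)[OF assms this]
  have "continuous_on {0..\<tau>} (\<lambda>t. integral {0..t} (\<lambda>s. f s (x s)))"
    by (rule indefinite_integral_continuous_1)
  from continuous_on_add[OF continuous_on_const[of _ "x 0"] this] show ?thesis
    by (rule continuous_on_eq) (rule caratheodory_solution_integral(2)[OF assms, symmetric])
next
  case False
  then have "{0..\<tau>} = {}"
    by simp
  then show ?thesis
    by (simp only: continuous_on_empty)
qed

text \<open>Turns an integrated equation back into a differential one. It is applied only where the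
  integrand is continuous: autonomous equations, or equations from which the merely integrable input
  has cancelled.\<close>

lemma has_vector_derivative_of_integral_eq:
  fixes y g :: "real \<Rightarrow> 'v::euclidean_space"
  assumes "continuous_on {0..\<tau>} g" "t \<in> {0..\<tau>}"
    and "\<And>t. t \<in> {0..\<tau>} \<Longrightarrow> y t = y 0 + integral {0..t} g"
  shows "(y has_vector_derivative g t) (at t within {0..\<tau>})"
proof -
  have "((\<lambda>t. y 0 + integral {0..t} g) has_vector_derivative g t) (at t within {0..\<tau>})"
    using has_vector_derivative_add[OF has_vector_derivative_const[of "y 0"]
        integral_has_vector_derivative[OF assms(1,2)]] by (simp only: add_0)
  with assms(2,3) show ?thesis
    by (rule has_vector_derivative_transform[of t _ y "\<lambda>t. y 0 + integral {0..t} g"])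
qed

text \<open>The product \<open>exp (lam * s) *\<^sub>R w s\<close> has zero derivative and is
  therefore constant.\<close>

lemma linear_decay:
  fixes w :: "real \<Rightarrow> 'v::euclidean_space"
  assumes "continuous_on {0..\<tau>} w"
    and "\<And>t. t \<in> {0..\<tau>} \<Longrightarrow> w t = w 0 + integral {0..t} (\<lambda>s. - lam *\<^sub>R w s)"
    and t: "t \<in> {0..\<tau>}"
  shows "w t = exp (- lam * t) *\<^sub>R w 0"
proof -
  have w': "(w has_vector_derivative - lam *\<^sub>R w s) (at s within {0..\<tau>})" if "s \<in> {0..\<tau>}" for s
    by (rule has_vector_derivative_of_integral_eq[OF _ that assms(2)])
      (intro continuous_intros assms(1))
  have "((\<lambda>s. exp (lam * s) *\<^sub>R w s) has_vector_derivative 0) (at s within {0..\<tau>})"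
    if "s \<in> {0..\<tau>}" for s
  proof -
    have "((\<lambda>s. exp (lam * s)) has_real_derivative lam * exp (lam * s)) (at s within {0..\<tau>})"
      by (auto intro!: derivative_eq_intros)
    from has_vector_derivative_scaleR[OF this w'[OF that]] show ?thesis
      by (simp add: algebra_simps)
  qed
  then have "exp (lam * t) *\<^sub>R w t = exp (lam * 0) *\<^sub>R w 0"
    using t by (intro has_derivative_zero_unique[of "{0..\<tau>}" "\<lambda>s. exp (lam * s) *\<^sub>R w s" t 0])
      (auto simp: has_vector_derivative_def)
  then have "exp (- lam * t) *\<^sub>R exp (lam * t) *\<^sub>R w t = exp (- lam * t) *\<^sub>R w 0"
    by simp
  then show ?thesis
    by (simp flip: exp_add)
qed

text \<open>The mismatch \<open>\<gamma> x - (A + \<lambda> I) \<zeta>\<^sub>1 - B \<zeta>\<^sub>2\<close> between the filter and the extended plant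
  obeys \<open>w' = - \<lambda> w\<close>, whatever the input.\<close>

definition mismatch ::
    "real ^ 'n ^ 'n \<Rightarrow> real ^ 'm ^ 'n \<Rightarrow> real \<Rightarrow> real \<Rightarrow> real ^ 'n \<Rightarrow> real ^ ('n + 'm) \<Rightarrow> real ^ 'n" where
  "mismatch A B lam gam x z = gam *\<^sub>R x - beside (A + mat lam) B *v z"

text \<open>As the mismatch is linear in plant and filter state, its value at the two velocities is
  its own velocity. The contributions of A x and B u from plant and filter cancel, and everything
  left carries the factor \<open>- lam\<close>.\<close>

lemma mismatch_derivative:
  "mismatch A B lam gam (A *v x + B *v u) (filter_rhs lam gam x u z)
    = - lam *\<^sub>R mismatch A B lam gam x z"
proof -
  obtain z1 z2 where z: "z = stack z1 z2"
    by (rule stack_cases)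
  show ?thesis
    unfolding mismatch_def filter_rhs_def z
    by (simp add: stack_algebra beside_matrix_vector_mult matrix_vector_mult_add_rdistrib
        mat_matrix_vector_mult matrix_vector_right_distrib algebra_simps matrix_vector_mult_scaleR
        vec.neg)
qed

text \<open>Expressing \<open>gam *\<^sub>R x\<close> through the mismatch eliminates the plant
  state: the filter becomes the extended plant driven by \<open>u\<close>, with the mismatch as an
  additive disturbance in the first block.\<close>

lemma filter_rhs_eq:
  "filter_rhs lam gam x u z =
    stack (beside A B) (beside 0 (mat (- lam))) *v z + stack 0 (mat gam) *v u
      + stack (mismatch A B lam gam x z) 0"
proof -
  obtain z1 z2 where z: "z = stack z1 z2"
    by (rule stack_cases)
  show ?thesis
    unfolding mismatch_def filter_rhs_def z
    by (simp add: stack_algebra beside_matrix_vector_mult matrix_vector_mult_add_rdistrib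
        mat_matrix_vector_mult stack_matrix_vector_mult)
qed

lemma mismatch_linear:
  shows "mismatch A B lam gam (x + x') (z + z') = mismatch A B lam gam x z + mismatch A B lam gam x' z'"
    and "mismatch A B lam gam (r *\<^sub>R x) (r *\<^sub>R z) = r *\<^sub>R mismatch A B lam gam x z"
  by (simp_all add: mismatch_def matrix_vector_right_distrib matrix_vector_mult_scaleR algebra_simps)

text \<open>A linear map commutes with the integrals in the solution concept, and the resulting
  integrand \<open>- lam *\<^sub>R mismatch ...\<close> is continuous even if \<open>u\<close> is
  not, so \<open>linear_decay\<close> applies.\<close>

lemma mismatch_decay:
  assumes "caratheodory_solution (\<lambda>t y. A *v y + B *v u t) \<tau> x"
    and "caratheodory_solution (\<lambda>t. filter_rhs lam gam (x t) (u t)) \<tau> z"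
    and t: "t \<in> {0..\<tau>}"
  shows "mismatch A B lam gam (x t) (z t) = exp (- lam * t) *\<^sub>R mismatch A B lam gam (x 0) (z 0)"
proof (rule linear_decay[OF _ _ t])
  note cont = assms(1,2)[THEN caratheodory_solution_continuous]
  show "continuous_on {0..\<tau>} (\<lambda>t. mismatch A B lam gam (x t) (z t))"
    unfolding mismatch_def
    by (intro continuous_on_diff continuous_on_scaleR continuous_on_const cont
        continuous_on_matrix_vector_mult)
  fix t assume t: "t \<in> {0..\<tau>}"
  let ?f = "\<lambda>s. A *v x s + B *v u s" and ?g = "\<lambda>s. filter_rhs lam gam (x s) (u s) (z s)"
  have int: "(?f has_integral integral {0..t} ?f) {0..t}" "(?g has_integral integral {0..t} ?g) {0..t}"
    by (intro integrable_integral caratheodory_solution_integral(1)[OF assms(1) t]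
        caratheodory_solution_integral(1)[OF assms(2) t])+
  have "((\<lambda>s. mismatch A B lam gam (?f s) (?g s)) has_integral
      mismatch A B lam gam (integral {0..t} ?f) (integral {0..t} ?g)) {0..t}"
    unfolding mismatch_def
    using has_integral_linear[OF int(2) matrix_vector_mul_bounded_linear[of "beside (A + mat lam) B"]]
    by (intro has_integral_diff has_integral_cmul int) (simp add: o_def)
  then have "integral {0..t} (\<lambda>s. - lam *\<^sub>R mismatch A B lam gam (x s) (z s))
      = mismatch A B lam gam (integral {0..t} ?f) (integral {0..t} ?g)"
    by (simp only: mismatch_derivative integral_unique)
  moreover have "mismatch A B lam gam (x t) (z t) = mismatch A B lam gam (x 0) (z 0)
      + mismatch A B lam gam (integral {0..t} ?f) (integral {0..t} ?g)"
    unfolding mismatch_linear(1)[symmetric]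
      caratheodory_solution_integral(2)[OF assms(1) t, symmetric]
      caratheodory_solution_integral(2)[OF assms(2) t, symmetric] ..
  ultimately show "mismatch A B lam gam (x t) (z t) = mismatch A B lam gam (x 0) (z 0)
      + integral {0..t} (\<lambda>s. - lam *\<^sub>R mismatch A B lam gam (x s) (z s))"
    by simp
qed

text \<open>Since \<open>zeta 0 = 0\<close>, the initial mismatch is
  \<open>gam *\<^sub>R x 0\<close>; the subtracted matrix thus collects exactly the samples of the
  disturbance in \<open>filter_rhs_eq\<close>.\<close>

lemma sampled_dynamics:
  fixes A :: "real ^ 'n ^ 'n" and B :: "real ^ 'm ^ 'n"
    and u :: "real \<Rightarrow> real ^ 'm" and x :: "real \<Rightarrow> real ^ 'n"
    and zeta :: "real \<Rightarrow> real ^ ('n + 'm)"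
  assumes "0 < T" "Ts = T / real CARD('k :: {finite, linorder})"
    and "input_state_trajectory A B T u x"
    and "caratheodory_solution (\<lambda>t. filter_rhs lam gam (x t) (u t)) T zeta" and "zeta 0 = 0"
  shows "samples Ts (\<lambda>t. filter_rhs lam gam (x t) (u t) (zeta t))
      - stack (mat gam) 0 ** samples Ts (\<lambda>t. exp (- lam * t) *\<^sub>R x 0) =
    stack (beside A B) (beside 0 (mat (- lam))) ** samples Ts zeta
      + stack 0 (mat gam) ** (samples Ts u :: real ^ ('k :: {finite, linorder}) ^ 'm)"
proof -
  have sampled: "M ** (samples Ts f :: real ^ ('k :: {finite, linorder}) ^ 'q) = samples Ts (\<lambda>t. M *v f t)"
    for M :: "real ^ 'q ^ 'p" and f
    by (simp add: vec_eq_iff samples_def matrix_matrix_mult_def matrix_vector_mult_def)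
  \<comment> \<open>The column position is at most N - 1; the cruder bound N already keeps every
    sampling instant inside \<open>{0..T}\<close>.\<close>
  have time: "real (card {..<j}) * Ts \<in> {0..T}" for j :: "'k :: {finite, linorder}"
  proof -
    have "card {..<j} \<le> CARD('k)"
      by (intro card_mono) auto
    moreover have "0 < Ts" "T = real CARD('k) * Ts"
      using assms(1,2) by simp_all
    ultimately show ?thesis
      by (simp add: mult_right_mono)
  qed
  have rhs: "filter_rhs lam gam (x t) (u t) (zeta t) - stack (mat gam) 0 *v (exp (- lam * t) *\<^sub>R x 0)
      = stack (beside A B) (beside 0 (mat (- lam))) *v zeta t + stack 0 (mat gam) *v u t"
    if "t \<in> {0..T}" for t
  proof -
    have "mismatch A B lam gam (x t) (zeta t) = exp (- lam * t) *\<^sub>R mismatch A B lam gam (x 0) (zeta 0)"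
      using assms that by (intro mismatch_decay) (auto simp: input_state_trajectory_def)
    then show ?thesis
      by (subst filter_rhs_eq[of _ _ _ _ _ A B])
        (simp add: stack_matrix_vector_mult mat_matrix_vector_mult assms(5) mismatch_def)
  qed
  show ?thesis
    unfolding sampled
    using rhs[OF time] by (simp add: vec_eq_iff samples_def)
qed

section \<open>Lyapunov functions\<close>

text \<open>The constant is the minimum of \<open>q\<close> over the compact unit sphere;
  homogeneity of degree two carries the bound to all vectors.\<close>

lemma quadratic_lower_bound:
  fixes q :: "'v::euclidean_space \<Rightarrow> real"
  assumes "continuous_on UNIV q" "\<And>r v. q (r *\<^sub>R v) = r\<^sup>2 * q v" "\<And>v. v \<noteq> 0 \<Longrightarrow> 0 < q v"
  obtains c where "0 < c" "\<And>v. c * (norm v)\<^sup>2 \<le> q v"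
proof -
  have "sphere (0::'v) 1 \<noteq> {}"
    by simp
  then obtain v0 where v0: "norm v0 = 1" "\<And>v. norm v = 1 \<Longrightarrow> q v0 \<le> q v"
    using continuous_attains_inf[of "sphere (0::'v) 1" q] continuous_on_subset[OF assms(1)]
    by auto
  have "0 < q v0"
    using v0(1) by (intro assms(3)) auto
  moreover have "q v0 * (norm v)\<^sup>2 \<le> q v" for v
  proof (cases "v = 0")
    case True
    then show ?thesis
      using assms(2)[of 0 0] by simp
  next
    case False
    have "q v0 * (norm v)\<^sup>2 \<le> q (v /\<^sub>R norm v) * (norm v)\<^sup>2"
      using False by (intro mult_right_mono v0(2)) auto
    also have "\<dots> = q v"
      using False by (simp add: assms(2) field_simps)
    finally show ?thesis .
  qed
  ultimately show ?thesis
    by (rule that)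
qed

text \<open>Along solutions V = b x x has derivative 2 b x (f x), which is at most -2 a V, so exp(2
  a t) V is nonincreasing. An abstract form \<open>b\<close> allows a Lyapunov function on the
  product space that is not given by a matrix.\<close>

lemma bilinear_Lyapunov_exponentially_stable:
  fixes f :: "'v::euclidean_space \<Rightarrow> 'v"
  assumes f: "linear f" and b: "bounded_bilinear b"
    and sym: "\<And>v w. b v w = b w v"
    and pos: "\<And>v. v \<noteq> 0 \<Longrightarrow> 0 < b v v"
    and neg: "\<And>v. v \<noteq> 0 \<Longrightarrow> b v (f v) < (0::real)"
  shows "origin_globally_exponentially_stable f"
proof -
  interpret bounded_bilinear b by fact
  have cf: "continuous_on S f" for S
    using f linear_continuous_on linear_conv_bounded_linear by blast
  obtain c1 where c1: "0 < c1" "\<And>v. c1 * (norm v)\<^sup>2 \<le> b v v"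
  proof (rule quadratic_lower_bound[of "\<lambda>v. b v v"])
    show "continuous_on UNIV (\<lambda>v. b v v)"
      by (intro continuous_on continuous_on_id)
  qed (use pos in \<open>auto simp: scaleR_left scaleR_right power2_eq_square\<close>)
  obtain c3 where c3: "0 < c3" "\<And>v. c3 * (norm v)\<^sup>2 \<le> - b v (f v)"
  proof (rule quadratic_lower_bound[of "\<lambda>v. - b v (f v)"])
    show "continuous_on UNIV (\<lambda>v. - b v (f v))"
      by (intro continuous_on_minus continuous_on continuous_on_id cf)
  qed (use neg in \<open>auto simp: scaleR_left scaleR_right power2_eq_square linear_scale[OF f]\<close>)
  obtain c2 where c2: "0 < c2" "\<And>v. b v v \<le> c2 * (norm v)\<^sup>2"
  proof -
    obtain K where "K > 0" "\<And>v w. norm (b v w) \<le> norm v * norm w * K"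
      using pos_bounded by blast
    then show ?thesis
      by (intro that[of K]) (auto simp: power2_eq_square mult_ac intro: order_trans[OF abs_ge_self])
  qed
  \<comment> \<open>The dissipation is at least c3 |v|^2, and |v|^2 is at least b v v / c2; hence
    this decay rate.\<close>
  define a where "a = c3 / c2"
  have a: "0 < a"
    using c2 c3 by (simp add: a_def)
  have rate: "b v (f v) + a * b v v \<le> 0" for v
  proof -
    have "a * b v v \<le> a * (c2 * (norm v)\<^sup>2)"
      using a c2 by (intro mult_left_mono) auto
    also have "\<dots> = c3 * (norm v)\<^sup>2"
      using c2 by (simp add: a_def)
    finally show ?thesis
      using c3(2)[of v] by linarith
  qed
  have bound: "norm (x t) \<le> sqrt (c2 / c1) * exp (- a * t) * norm (x 0)"
    if sol: "caratheodory_solution (\<lambda>_. f) \<tau> x" and t: "t \<in> {0..\<tau>}" for \<tau> x t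
  proof -
    let ?V = "\<lambda>t. b (x t) (x t)" and ?W = "\<lambda>t. exp (2 * a * t) * b (x t) (x t)"
    note cx = caratheodory_solution_continuous[OF sol]
    have x': "(x has_vector_derivative f (x s)) (at s within {0..\<tau>})" if "s \<in> {0..\<tau>}" for s
      by (rule has_vector_derivative_of_integral_eq[OF _ that caratheodory_solution_integral(2)[OF sol]])
        (rule continuous_on_compose2[OF cf cx subset_UNIV])
    have W': "\<exists>y. (?W has_real_derivative y) (at s) \<and> y \<le> 0" if "0 < s" "s < t" for s
    proof -
      have "at s within {0..\<tau>} = at s"
        using that t by (intro at_within_interior) auto
      with x'[of s] have x's: "(x has_vector_derivative f (x s)) (at s)"
        using that t by auto
      from has_vector_derivative[OF x's x's]
      have V': "(?V has_real_derivative 2 * b (x s) (f (x s))) (at s)"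
        by (simp add: has_real_derivative_iff_has_vector_derivative sym[of "f (x s)"])
      have "(?W has_real_derivative exp (2 * a * s) * (2 * b (x s) (f (x s)))
          + 2 * a * exp (2 * a * s) * ?V s) (at s)"
        by (rule derivative_eq_intros V' refl | simp)+
      moreover have "exp (2 * a * s) * (2 * b (x s) (f (x s))) + 2 * a * exp (2 * a * s) * ?V s
          = 2 * exp (2 * a * s) * (b (x s) (f (x s)) + a * ?V s)"
        by (simp add: algebra_simps)
      ultimately show ?thesis
        using rate[of "x s"] by (auto simp: mult_le_0_iff intro!: exI)
    qed
    have cx': "continuous_on {0..t} x"
      using cx by (rule continuous_on_subset) (use t in auto)
    have "?W t \<le> ?W 0"
    proof (cases "t = 0")
      case False
      then show ?thesis
        using t W' by (intro DERIV_nonpos_imp_decreasing_open[of 0 t ?W])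
          (auto intro!: continuous_intros continuous_on cx')
    qed simp
    then have W: "exp (2 * a * t) * ?V t \<le> ?V 0"
      by simp
    \<comment> \<open>Sandwiching V between c1 |x|^2 and c2 |x|^2 costs the overshoot factor sqrt(c2
      / c1).\<close>
    have "c1 * (norm (x t))\<^sup>2 \<le> exp (- (2 * a * t)) * (exp (2 * a * t) * ?V t)"
      using c1(2)[of "x t"] by (simp flip: exp_add mult.assoc)
    also have "\<dots> \<le> exp (- (2 * a * t)) * (c2 * (norm (x 0))\<^sup>2)"
      using W c2(2)[of "x 0"] by (intro mult_left_mono) auto
    finally have "(norm (x t))\<^sup>2 \<le> (c2 / c1) * (exp (- a * t))\<^sup>2 * (norm (x 0))\<^sup>2"
      using c1(1) by (simp add: field_simps power2_eq_square flip: exp_add)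
    also have "\<dots> = (sqrt (c2 / c1) * exp (- a * t) * norm (x 0))\<^sup>2"
      using c1(1) c2(1) by (simp add: power_mult_distrib)
    finally show ?thesis
      by (rule power2_le_imp_le) (use c1(1) c2(1) in simp)
  qed
  show ?thesis
    unfolding origin_globally_exponentially_stable_def
  proof (rule conjI, rule linear_0[OF f], rule exI[of _ "sqrt (c2 / c1)"], rule conjI)
    show "\<exists>\<alpha>>0. \<forall>\<tau>>0. \<forall>x. caratheodory_solution (\<lambda>_. f) \<tau> x \<longrightarrow>
        (\<forall>t\<in>{0..\<tau>}. norm (x t) \<le> sqrt (c2 / c1) * exp (- \<alpha> * t) * norm (x 0))"
      using bound a by blast
  qed (use c1(1) c2(1) in simp)
qed

section \<open>Lyapunov inequalities for matrices\<close>

text \<open>Split a complex eigenvector into a + i b. Adding the real inequalities for a and b, the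
  terms with \<open>Im l\<close> cancel by symmetry of \<open>S\<close>, and what remains is
  \<open>Re l\<close> times a nonnegative number.\<close>

lemma Lyapunov_hurwitz:
  fixes M S :: "real ^ 'p ^ 'p"
  assumes S: "pos_def S" and neg: "\<And>v. v \<noteq> 0 \<Longrightarrow> v \<bullet> (S *v (M *v v)) < 0"
  shows "hurwitz M"
  unfolding hurwitz_def complex_eigenvalue_def
proof (intro allI impI, elim exE conjE)
  fix l :: complex and v :: "complex ^ 'p"
  assume v: "v \<noteq> 0" and eig: "(\<chi> i j. complex_of_real (M $ i $ j)) *v v = l *s v"
  define a b where "a = (\<chi> i. Re (v $ i))" and "b = (\<chi> i. Im (v $ i))"
  have ab: "a \<noteq> 0 \<or> b \<noteq> 0"
    using v by (auto simp: a_def b_def vec_eq_iff complex_eq_iff)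
  have comp: "(\<Sum>j\<in>UNIV. complex_of_real (M $ i $ j) * v $ j) = l * v $ i" for i
    using arg_cong[OF eig, of "\<lambda>w. w $ i"] by (simp add: matrix_vector_mult_def)
  have Ma: "M *v a = Re l *\<^sub>R a - Im l *\<^sub>R b"
    using arg_cong[OF comp, of Re] by (simp add: a_def b_def vec_eq_iff matrix_vector_mult_def)
  have Mb: "M *v b = Re l *\<^sub>R b + Im l *\<^sub>R a"
    using arg_cong[OF comp, of Im] by (simp add: a_def b_def vec_eq_iff matrix_vector_mult_def)
  have le: "0 \<le> w \<bullet> (S *v w)" "w \<bullet> (S *v (M *v w)) \<le> 0" for w
    using S neg[of w] unfolding pos_def_def by (cases "w = 0"; force)+
  have "a \<bullet> (S *v (M *v a)) + b \<bullet> (S *v (M *v b)) < 0"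
    using ab neg le(2)[of a] le(2)[of b] by (metis add_less_le_mono add_le_less_mono add_0)
  moreover have "a \<bullet> (S *v (M *v a)) + b \<bullet> (S *v (M *v b)) = Re l * (a \<bullet> (S *v a) + b \<bullet> (S *v b))"
    using inner_symmetric_matrix[of S a b] S unfolding Ma Mb pos_def_def
    by (simp add: matrix_vector_right_distrib matrix_vector_mult_diff_distrib matrix_vector_mult_scaleR
        inner_add_right inner_diff_right algebra_simps)
  ultimately show "Re l < 0"
    using le(1)[of a] le(1)[of b] by (smt (verit) mult_nonneg_nonneg)
qed

lemma pos_def_inverse:
  assumes "pos_def P"
  shows "matrix_inv P ** P = mat 1" "P ** matrix_inv P = mat 1" "pos_def (matrix_inv P)"
proof -
  have "inj ((*v) P)"
    using assms by (force simp: pos_def_def vec.inj_iff_eq_0)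
  then have "invertible P"
    by (simp add: invertible_left_inverse matrix_left_invertible_injective)
  then have "P ** matrix_inv P = mat 1 \<and> matrix_inv P ** P = mat 1"
    unfolding matrix_inv_def invertible_def by (rule someI_ex)
  then show inv: "matrix_inv P ** P = mat 1" "P ** matrix_inv P = mat 1"
    by simp_all
  have P: "transpose P = P" "\<And>w. w \<noteq> 0 \<Longrightarrow> 0 < w \<bullet> (P *v w)"
    using assms by (auto simp: pos_def_def)
  have "transpose (matrix_inv P) ** P = mat 1"
    using arg_cong[OF inv(2), of transpose] by (simp add: matrix_transpose_mul P transpose_mat)
  then have "transpose (matrix_inv P) = matrix_inv P"
    using matrix_mul_assoc[of "transpose (matrix_inv P)" P "matrix_inv P"] by (simp add: inv)
  moreover have "0 < v \<bullet> (matrix_inv P *v v)" if "v \<noteq> 0" for v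
  proof -
    have v: "P *v (matrix_inv P *v v) = v"
      by (simp add: matrix_vector_mul_assoc inv)
    with that have "matrix_inv P *v v \<noteq> 0"
      by auto
    from P(2)[OF this] show ?thesis
      by (simp add: v inner_commute)
  qed
  ultimately show "pos_def (matrix_inv P)"
    by (simp add: pos_def_def)
qed

text \<open>Congruence by the inverse of \<open>P\<close>: with v = P w, the quadratic form of the
  hypothesis at w is twice w \<bullet> (M v).\<close>

lemma Lyapunov_inequality_inverse:
  assumes P: "pos_def P" and neg: "neg_def (M ** P + transpose (M ** P))" and v: "v \<noteq> 0"
  shows "v \<bullet> (matrix_inv P *v (M *v v)) < 0"
proof -
  define w where "w = matrix_inv P *v v"
  have Pw: "P *v w = v"
    by (simp add: w_def matrix_vector_mul_assoc pos_def_inverse[OF P])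
  with v have "w \<noteq> 0"
    by auto
  then have "w \<bullet> ((M ** P + transpose (M ** P)) *v w) < 0"
    using neg by (simp add: neg_def_def)
  then have "w \<bullet> (M *v v) < 0"
    by (simp only: matrix_vector_mult_add_rdistrib inner_add_right inner_transpose_matrix
        matrix_vector_mul_assoc[symmetric] Pw)
  moreover have "v \<bullet> (matrix_inv P *v (M *v v)) = (M *v v) \<bullet> w"
    unfolding w_def using pos_def_inverse(3)[OF P] by (intro inner_symmetric_matrix) (simp add: pos_def_def)
  ultimately show ?thesis
    by (simp add: inner_commute)
qed

section \<open>Stability of the plant-controller interconnection\<close>

text \<open>In the coordinates z and w = mismatch the loop is a cascade: z' = M z + (w, 0) and w' =
  - lam w. Hence z \<bullet> S z + c |w|^2 is a Lyapunov function once c is large enough to dominate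
  the coupling.\<close>

lemma closed_loop_exponentially_stable:
  fixes A :: "real ^ 'n ^ 'n" and B :: "real ^ 'm ^ 'n" and K :: "real ^ ('n + 'm) ^ 'm"
  assumes lam: "0 < lam" and gam: "gam \<noteq> 0" and S: "pos_def S"
    and M: "M = stack (beside A B) (beside 0 (mat (- lam))) + stack 0 (mat gam) ** K"
    and neg: "\<And>v. v \<noteq> 0 \<Longrightarrow> v \<bullet> (S *v (M *v v)) < 0"
  shows "origin_globally_exponentially_stable (closed_loop A B lam gam K)"
proof -
  let ?w = "\<lambda>v. mismatch A B lam gam (fst v) (snd v)" and ?f = "closed_loop A B lam gam K"
  have f: "snd (?f v) = M *v snd v + stack (?w v) 0" "?w (?f v) = - lam *\<^sub>R ?w v" for v
  proof -
    show "snd (?f v) = M *v snd v + stack (?w v) 0"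
      unfolding closed_loop_def Let_def M
      by (simp add: case_prod_beta' filter_rhs_eq[of _ _ _ _ _ A B]
          matrix_vector_mult_add_rdistrib matrix_vector_mul_assoc[symmetric])
    show "?w (?f v) = - lam *\<^sub>R ?w v"
      using mismatch_derivative by (simp add: closed_loop_def Let_def case_prod_beta')
  qed
  obtain a where a: "0 < a" "\<And>z. a * (norm z)\<^sup>2 \<le> - (z \<bullet> (S *v (M *v z)))"
  proof (rule quadratic_lower_bound[of "\<lambda>z. - (z \<bullet> (S *v (M *v z)))"])
    show "continuous_on UNIV (\<lambda>z. - (z \<bullet> (S *v (M *v z))))"
      by (intro continuous_on_minus continuous_on_inner continuous_on_id
          continuous_on_matrix_vector_mult)
  qed (use neg in \<open>auto simp: matrix_vector_mult_scaleR power2_eq_square\<close>)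
  have "bounded_linear (\<lambda>w :: real ^ 'n. S *v stack w 0)"
    unfolding linear_conv_bounded_linear[symmetric]
    by (rule linearI)
      (simp_all add: stack_algebra matrix_vector_right_distrib[symmetric] matrix_vector_mult_scaleR[symmetric]
        del: matrix_vector_right_distrib matrix_vector_mult_scaleR)
  then obtain k where k: "0 < k" "\<And>w :: real ^ 'n. norm (S *v stack w 0) \<le> norm w * k"
    using bounded_linear.pos_bounded by blast
  \<comment> \<open>Here \<open>a\<close> is the dissipation of the z part and \<open>k\<close>
    bounds the coupling. This choice makes c lam = k^2 / a, twice what is needed to absorb the cross
    term k |z| |w| together with half of a |z|^2.\<close>
  define c where "c = k\<^sup>2 / (a * lam)"
  have c: "0 < c"
    using a k lam by (simp add: c_def)
  define b where "b = (\<lambda>v v'. snd v \<bullet> (S *v snd v') + c * (?w v \<bullet> ?w v'))"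
  show ?thesis
  proof (rule bilinear_Lyapunov_exponentially_stable[of _ b])
    show "linear ?f"
      by (rule linearI) (auto simp: closed_loop_def Let_def filter_rhs_def matrix_vector_right_distrib
          matrix_vector_mult_scaleR algebra_simps stack_algebra)
    show "bounded_bilinear b"
      unfolding bilinear_conv_bounded_bilinear[symmetric] bilinear_def b_def
      by (auto intro!: linearI simp: mismatch_linear matrix_vector_right_distrib
          matrix_vector_mult_scaleR inner_add_left inner_add_right algebra_simps)
    show "b v v' = b v' v" for v v'
      unfolding b_def using S
      by (simp add: inner_commute[of "?w v"] inner_symmetric_matrix[of S "snd v"] pos_def_def)
    fix v :: "(real ^ 'n) \<times> (real ^ ('n + 'm))" assume v: "v \<noteq> 0"
    let ?z = "snd v"
    \<comment> \<open>If both vanished, then \<open>gam *\<^sub>R x = 0\<close> and so x = 0: the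
      new coordinates determine the state.\<close>
    have zw: "?z \<noteq> 0 \<or> ?w v \<noteq> 0"
      using v gam by (auto simp: mismatch_def prod_eq_iff)
    have "0 \<le> z \<bullet> (S *v z)" "z \<noteq> 0 \<Longrightarrow> 0 < z \<bullet> (S *v z)" for z
      using S unfolding pos_def_def by (cases "z = 0"; force)+
    then show "0 < b v v"
      unfolding b_def using zw c by (cases "?z = 0") (auto intro: add_pos_nonneg add_nonneg_pos)
    have "?z \<bullet> (S *v stack (?w v) 0) \<le> norm ?z * norm (S *v stack (?w v) 0)"
      by (rule norm_cauchy_schwarz)
    also have "\<dots> \<le> norm ?z * (norm (?w v) * k)"
      by (intro mult_left_mono k) simp
    finally have "?z \<bullet> (S *v stack (?w v) 0) \<le> norm ?z * (norm (?w v) * k)" .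
    moreover have "b v (?f v) = ?z \<bullet> (S *v (M *v ?z)) + ?z \<bullet> (S *v stack (?w v) 0)
        - c * lam * (norm (?w v))\<^sup>2"
    proof -
      have "b v (?f v) = ?z \<bullet> (S *v snd (?f v)) + c * (?w v \<bullet> ?w (?f v))"
        by (simp add: b_def)
      also have "?w v \<bullet> ?w (?f v) = - lam * (norm (?w v))\<^sup>2"
        by (simp only: f(2) power2_norm_eq_inner inner_scaleR_right)
      finally show ?thesis
        by (simp add: f(1) matrix_vector_right_distrib inner_add_right)
    qed
    ultimately have "b v (?f v) \<le>
        - a * (norm ?z)\<^sup>2 + k * norm ?z * norm (?w v) - c * lam * (norm (?w v))\<^sup>2"
      using a(2)[of ?z] by (simp add: mult_ac)
    \<comment> \<open>Completing the square leaves half of each of the two diagonal terms.\<close>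
    also have "\<dots> = - (a * (norm ?z)\<^sup>2 + (k * norm (?w v))\<^sup>2 / a + (a * norm ?z - k * norm (?w v))\<^sup>2 / a) / 2"
      using a lam by (simp add: c_def field_simps power2_eq_square)
    also have "\<dots> < 0"
    proof -
      have "0 < a * (norm ?z)\<^sup>2 + (k * norm (?w v))\<^sup>2 / a"
      proof (cases "?z = 0")
        case True
        with zw have "0 < (k * norm (?w v))\<^sup>2 / a"
          using a(1) k(1) by (intro divide_pos_pos zero_less_power mult_pos_pos) simp_all
        with True show ?thesis
          by simp
      next
        case False
        then have "0 < a * (norm ?z)\<^sup>2"
          using a(1) by simp
        moreover have "0 \<le> (k * norm (?w v))\<^sup>2 / a"
          using a(1) by simp
        ultimately show ?thesis
          by (rule add_pos_nonneg)
      qed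
      moreover have "0 \<le> (a * norm ?z - k * norm (?w v))\<^sup>2 / a"
        using a(1) by simp
      ultimately show ?thesis
        unfolding minus_divide_left[symmetric] neg_less_0_iff_less half_gt_zero_iff
        by (rule add_pos_nonneg)
    qed
    finally show "b v (?f v) < 0" .
  qed
qed

section \<open>Feasibility\<close>

text \<open>Extracts a sign, or an equation, from an inequality that holds along a whole ray, or
  line, of test matrices or inputs.\<close>

lemma affine_nonneg_slope:
  fixes c d :: real
  shows "(\<And>r. 0 \<le> r \<Longrightarrow> 0 \<le> c + r * d) \<Longrightarrow> 0 \<le> d"
    and "(\<And>r. 0 \<le> c + r * d) \<Longrightarrow> d = 0"
proof -
  have *: "\<exists>r\<ge>0. c + r * e < 0" if "e < 0" for e
  proof (intro exI conjI)
    \<comment> \<open>The witness is chosen so that r e = -(|c| + 1), which outweighs c.\<close>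
    show "0 \<le> (\<bar>c\<bar> + 1) / (- e)"
      using that by (intro divide_nonneg_pos) auto
    have "(\<bar>c\<bar> + 1) / (- e) * e = - (\<bar>c\<bar> + 1)"
      using that by simp
    then show "c + (\<bar>c\<bar> + 1) / (- e) * e < 0"
      by linarith
  qed
  show "0 \<le> d" if "\<And>r. 0 \<le> r \<Longrightarrow> 0 \<le> c + r * d"
    using that * by (meson not_le)
  show "d = 0" if "\<And>r. 0 \<le> c + r * d"
  proof (rule ccontr)
    assume "d \<noteq> 0"
    then consider "d < 0" | "- d < 0"
      by linarith
    then show False
    proof cases
      case 1
      then show ?thesis
        using *[of d] that by (meson not_le)
    next
      case 2
      then obtain r where "c + r * (- d) < 0"
        using * by blast
      then show ?thesis
        using that[of "- r"] by simp
    qed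
  qed
qed

text \<open>Since the hypothesis forces \<open>H B = 0\<close>, the storage function \<open>x \<bullet> H x\<close> is nondecreasing
  along every trajectory, so no state where it is positive can be steered to \<open>0\<close>.\<close>

lemma controllable_no_increasing_storage:
  assumes ctrl: "controllable A B" and H: "transpose H = H"
    and incr: "\<And>x e. 0 \<le> x \<bullet> (H *v (A *v x + B *v e))"
  shows "x0 \<bullet> (H *v x0) \<le> 0"
proof -
  \<comment> \<open>The input enters \<open>incr\<close> linearly with arbitrary sign and size, so
    its coefficient must vanish.\<close>
  have HB: "H *v (B *v e) = 0" for e
  proof -
    have "v \<bullet> (H *v (B *v e)) = 0" for v
    proof (rule affine_nonneg_slope(2))
      show "0 \<le> v \<bullet> (H *v (A *v v)) + r * (v \<bullet> (H *v (B *v e)))" for r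
        using incr[of v "r *\<^sub>R e"]
        by (simp add: matrix_vector_right_distrib matrix_vector_mult_scaleR inner_add_right)
    qed
    then show ?thesis
      by (metis inner_eq_zero_iff)
  qed
  have HA: "0 \<le> v \<bullet> (H *v (A *v v))" for v
    using incr[of v 0] by simp
  obtain \<tau> u x where \<tau>: "0 < \<tau>" and traj: "input_state_trajectory A B \<tau> u x"
    and x: "x 0 = x0" "x \<tau> = 0"
    using ctrl unfolding controllable_def by meson
  have sol: "caratheodory_solution (\<lambda>t y. A *v y + B *v u t) \<tau> x"
    using traj by (simp add: input_state_trajectory_def)
  note cx = caratheodory_solution_continuous[OF sol]
  \<comment> \<open>With an input that is only integrable, x need not be differentiable everywhere;
    but H annihilates B, so \<open>H *v x\<close> has a continuous velocity.\<close>
  have Hx': "((\<lambda>t. H *v x t) has_vector_derivative H *v (A *v x t)) (at t within {0..\<tau>})"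
    if t: "t \<in> {0..\<tau>}" for t
  proof (rule has_vector_derivative_of_integral_eq[OF _ t])
    show "continuous_on {0..\<tau>} (\<lambda>t. H *v (A *v x t))"
      by (intro continuous_on_matrix_vector_mult cx)
    fix t assume t: "t \<in> {0..\<tau>}"
    have "integral {0..t} (\<lambda>s. H *v (A *v x s)) = integral {0..t} ((*v) H \<circ> (\<lambda>s. A *v x s + B *v u s))"
      by (simp add: o_def matrix_vector_right_distrib HB)
    also have "\<dots> = H *v integral {0..t} (\<lambda>s. A *v x s + B *v u s)"
      by (intro integral_linear caratheodory_solution_integral(1)[OF sol t]) simp
    finally show "H *v x t = H *v x 0 + integral {0..t} (\<lambda>s. H *v (A *v x s))"
      using caratheodory_solution_integral(2)[OF sol t] by (simp add: matrix_vector_right_distrib)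
  qed
  let ?V = "\<lambda>t. x t \<bullet> (H *v x t)"
  \<comment> \<open>The product rule would need a derivative of x. Symmetry of H factors the
    increment of V as (x t + x s) \<bullet> (H x t - H x s) instead, so continuity of x and
    differentiability of \<open>H *v x\<close> suffice.\<close>
  have "\<exists>y. (?V has_real_derivative y) (at s) \<and> 0 \<le> y" if s: "0 < s" "s < \<tau>" for s
  proof -
    have int: "s \<in> interior {0..\<tau>}"
      using s by simp
    have "s \<in> {0..\<tau>}"
      using s by simp
    from Hx'[OF this] have "((\<lambda>t. H *v x t) has_vector_derivative H *v (A *v x s)) (at s)"
      by (simp only: at_within_interior[OF int])
    then have "((\<lambda>t. (H *v x t) $ i) has_real_derivative (H *v (A *v x s)) $ i) (at s)" for i
      unfolding has_real_derivative_iff_has_vector_derivative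
      by (rule bounded_linear.has_vector_derivative[OF bounded_linear_vec_nth[of i]])
    then have slope: "(\<lambda>t. ((H *v x t) $ i - (H *v x s) $ i) / (t - s)) \<midarrow>s\<rightarrow> (H *v (A *v x s)) $ i" for i
      by (simp add: has_field_derivative_iff)
    have "x \<midarrow>s\<rightarrow> x s"
      using continuous_on_interior[OF cx int] by (simp add: isCont_def)
    then have "(\<lambda>t. \<Sum>i\<in>UNIV. (x t + x s) $ i * (((H *v x t) $ i - (H *v x s) $ i) / (t - s)))
        \<midarrow>s\<rightarrow> (\<Sum>i\<in>UNIV. (x s + x s) $ i * (H *v (A *v x s)) $ i)"
      by (intro tendsto_sum tendsto_mult[OF _ slope] tendsto_vec_nth tendsto_add tendsto_const)
    moreover have "(?V t - ?V s) / (t - s)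
        = (\<Sum>i\<in>UNIV. (x t + x s) $ i * (((H *v x t) $ i - (H *v x s) $ i) / (t - s)))" for t
    proof -
      have "?V t - ?V s = (x t + x s) \<bullet> (H *v x t - H *v x s)"
        using inner_symmetric_matrix[OF H, of "x t" "x s"] by (simp add: algebra_simps inner_add_left)
      then show ?thesis
        by (simp add: inner_vec_def sum_divide_distrib)
    qed
    ultimately have "(?V has_real_derivative (x s + x s) \<bullet> (H *v (A *v x s))) (at s)"
      by (simp add: has_field_derivative_iff inner_vec_def)
    then show ?thesis
      using HA[of "x s"] by (intro exI conjI) (assumption, simp only: inner_add_left add_nonneg_nonneg)
  qed
  moreover have "continuous_on {0..\<tau>} ?V"
    by (intro continuous_on_inner continuous_on_matrix_vector_mult cx)
  ultimately have "?V 0 \<le> ?V \<tau>"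
    using \<tau> by (intro DERIV_nonneg_imp_increasing_open[of 0 \<tau> ?V]) auto
  then show ?thesis
    by (simp add: x)
qed

text \<open>An unbounded ray of positive definite matrices: the identity keeps it strictly definite,
  while large \<open>r\<close> isolates the direction \<open>v\<close>.\<close>

lemma pos_def_add_outer:
  assumes "0 \<le> r"
  shows "pos_def (mat 1 + r *\<^sub>R outer v v)"
  unfolding pos_def_def
proof (intro conjI allI impI)
  show "transpose (mat 1 + r *\<^sub>R outer v v) = mat 1 + r *\<^sub>R outer v v"
    by (simp add: transpose_add transpose_scaleR transpose_outer transpose_mat)
  fix w :: "real ^ 'a" assume "w \<noteq> 0"
  then have "0 < w \<bullet> w + r * (v \<bullet> w)\<^sup>2"
    using assms by (intro add_pos_nonneg) auto
  then show "0 < w \<bullet> ((mat 1 + r *\<^sub>R outer v v) *v w)"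
    by (simp add: matrix_vector_mult_add_rdistrib inner_add_right outer_matrix_vector_mult
        inner_commute power2_eq_square flip: scaleR_matrix_vector_assoc)
qed

lemma convex_pos_def: "convex {P :: real ^ 'p ^ 'p. pos_def P}"
proof -
  have "{P :: real ^ 'p ^ 'p. pos_def P}
      = {P. transpose P = P} \<inter> (\<Inter>v\<in>- {0}. {P. outer v v \<bullet> P > 0})"
    by (auto simp: pos_def_def inner_outer inner_commute[of "outer _ _"])
  moreover have "convex {P :: real ^ 'p ^ 'p. transpose P = P}"
    by (rule convexI) (simp add: transpose_add transpose_scaleR)
  ultimately show ?thesis
    by (simp add: convex_Int convex_INT convex_halfspace_gt)
qed

text \<open>Theorem of alternatives: if the LMI were infeasible, the separating hyperplane would be
  a nonzero \<open>a\<close> satisfying the dual inequalities.\<close>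

lemma LMI_alternative:
  fixes F :: "real ^ 'p ^ 'p" and G :: "real ^ 'q ^ 'p"
  assumes dual: "\<And>a. \<lbrakk>transpose a = a; \<And>v. 0 \<le> v \<bullet> (a *v v); \<And>e. a *v (G *v e) = 0;
      \<And>v. 0 \<le> v \<bullet> (a *v (F *v v))\<rbrakk> \<Longrightarrow> a = 0"
  obtains P Y where "pos_def P"
    "neg_def ((F ** P + G ** Y) + transpose (F ** P + G ** Y))"
proof -
  \<comment> \<open>The slack \<open>S\<close> turns the strict inequality into the equation
    \<open>?L = 0\<close>, so infeasibility says that 0 misses a convex set.\<close>
  let ?L = "\<lambda>(P, Y, S). (F ** P + G ** Y) + transpose (F ** P + G ** Y) + S"
  let ?D = "{P. pos_def P} \<times> UNIV \<times> {S. pos_def S}"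
  have "linear ?L"
    by (rule linearI) (auto simp: matrix_add_ldistrib scaleR_matrix_mult transpose_add
        transpose_scaleR algebra_simps)
  then have conv: "convex (?L ` ?D)"
    by (intro convex_linear_image convex_Times convex_pos_def convex_UNIV)
  have one: "pos_def (mat 1 :: real ^ 'p ^ 'p)"
    using pos_def_add_outer[of 0] by simp
  have "0 \<in> ?L ` ?D"
  proof (rule ccontr)
    assume "0 \<notin> ?L ` ?D"
    moreover have "?L ` ?D \<noteq> {}"
      using one by auto
    ultimately obtain a where a: "a \<in> span (?L ` ?D)" "a \<noteq> 0" "\<And>x. x \<in> ?L ` ?D \<Longrightarrow> 0 \<le> a \<bullet> x"
      using separating_hyperplane_set_0_inspan[OF conv] by blast
    \<comment> \<open>The normal \<open>a\<close> was taken in the span of the image, which consists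
      of symmetric matrices; this is what makes \<open>a\<close> symmetric and still
      nonzero.\<close>
    have "span (?L ` ?D) \<subseteq> {X. transpose X = X}"
      by (rule span_minimal)
        (auto simp: transpose_add pos_def_def transpose_transpose transpose_scaleR
          subspace_def transpose_def[of 0] vec_eq_iff algebra_simps)
    with a(1) have sym: "transpose a = a"
      by blast
    have sep: "0 \<le> a \<bullet> (F ** P + G ** Y) + a \<bullet> transpose (F ** P + G ** Y) + a \<bullet> S"
      if "pos_def P" "pos_def S" for P Y S
      using a(3)[of "?L (P, Y, S)"] that by (force simp: inner_add_right)
    \<comment> \<open>The three dual conditions come from moving one variable at a time: S along v
      v^T, then Y along all multiples of e q^T, then P along v v^T.\<close>
    have pos: "0 \<le> v \<bullet> (a *v v)" for v
    proof (rule affine_nonneg_slope(1))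
      show "0 \<le> (a \<bullet> F + a \<bullet> transpose F + a \<bullet> mat 1) + r * (v \<bullet> (a *v v))" if "0 \<le> r" for r
        using sep[OF one pos_def_add_outer[OF that, of v], of 0]
        by (simp add: inner_add_right inner_outer algebra_simps)
    qed
    have G: "a *v (G *v e) = 0" for e
    proof -
      have "q \<bullet> (a *v (G *v e)) = 0" for q
      proof -
        have "2 * (q \<bullet> (a *v (G *v e))) = 0"
        proof (rule affine_nonneg_slope(2))
          show "0 \<le> (a \<bullet> F + a \<bullet> transpose F + a \<bullet> mat 1) + r * (2 * (q \<bullet> (a *v (G *v e))))" for r
            using sep[OF one one, of "r *\<^sub>R outer e q"] inner_symmetric_matrix[OF sym, of "G *v e" q]
            by (simp add: inner_add_right inner_outer scaleR_matrix_mult matrix_mult_outer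
                transpose_add transpose_scaleR transpose_outer algebra_simps)
        qed
        then show ?thesis
          by simp
      qed
      then show ?thesis
        by (metis inner_eq_zero_iff)
    qed
    have F: "0 \<le> v \<bullet> (a *v (F *v v))" for v
    proof -
      have "0 \<le> 2 * (v \<bullet> (a *v (F *v v)))"
      proof (rule affine_nonneg_slope(1))
        show "0 \<le> (a \<bullet> F + a \<bullet> transpose F + a \<bullet> mat 1) + r * (2 * (v \<bullet> (a *v (F *v v))))"
          if "0 \<le> r" for r
          using sep[OF pos_def_add_outer[OF that, of v] one, of 0]
            inner_symmetric_matrix[OF sym, of "F *v v" v]
          by (simp add: inner_add_right inner_outer scaleR_matrix_mult matrix_mult_outer
              matrix_add_ldistrib transpose_add transpose_scaleR transpose_outer algebra_simps)
      qed
      then show ?thesis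
        by simp
    qed
    have "a = 0"
      using sym pos G F by (rule dual)
    with a(2) show False ..
  qed
  then obtain P Y S where P: "pos_def P" and S: "pos_def S"
    and "(F ** P + G ** Y) + transpose (F ** P + G ** Y) + S = 0"
    by force
  then have eq: "(F ** P + G ** Y) + transpose (F ** P + G ** Y) = - S"
    by (simp add: eq_neg_iff_add_eq_0)
  have "(- S) *v v = - (S *v v)" for v
    by (simp add: vec_eq_iff matrix_vector_mult_def sum_negf)
  moreover have "transpose (- S) = - S"
    using S by (simp add: pos_def_def transpose_def vec_eq_iff)
  ultimately have "neg_def (- S)"
    using S by (simp add: pos_def_def neg_def_def)
  with P show ?thesis
    by (intro that[of P Y]) (simp_all only: eq)
qed

text \<open>A dual multiplier vanishes on the range of \<open>G\<close>, the whole second block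
  since \<open>gam \<noteq> 0\<close>, so only its upper left block H survives. The first block of F
  (x, e) is A x + B e, so the filter component e acts as a free plant input and controllability
  makes H nonpositive.\<close>

lemma extended_plant_LMI:
  fixes A :: "real ^ 'n ^ 'n" and B :: "real ^ 'm ^ 'n"
  assumes ctrl: "controllable A B" and gam: "gam \<noteq> 0"
    and F: "F = stack (beside A B) (beside 0 (mat (- lam)))" and G: "G = stack 0 (mat gam)"
  obtains P Y where "pos_def P"
    "neg_def ((F ** P + G ** Y) + transpose (F ** P + G ** Y))"
proof (rule LMI_alternative)
  fix a :: "real ^ ('n + 'm) ^ ('n + 'm)"
  assume sym: "transpose a = a" and pos: "\<And>v. 0 \<le> v \<bullet> (a *v v)"
    and aG: "\<And>e. a *v (G *v e) = 0" and aF: "\<And>v. 0 \<le> v \<bullet> (a *v (F *v v))"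
  have a2: "a *v stack 0 e = 0" for e
    using aG[of "e /\<^sub>R gam"] gam by (simp add: G stack_matrix_vector_mult mat_matrix_vector_mult)
  have split: "stack x e = stack x 0 + stack 0 e" for x :: "real ^ 'n" and e :: "real ^ 'm"
    by (simp add: stack_algebra)
  have form: "stack x e \<bullet> (a *v stack y f) = stack x 0 \<bullet> (a *v stack y 0)" for x y e f
  proof -
    have "stack x e \<bullet> (a *v stack y f) = stack x e \<bullet> (a *v stack y 0)"
      by (subst (2) split) (simp add: matrix_vector_right_distrib a2)
    also have "\<dots> = stack y 0 \<bullet> (a *v stack x e)"
      by (rule inner_symmetric_matrix[OF sym])
    also have "\<dots> = stack y 0 \<bullet> (a *v stack x 0)"
      by (subst split) (simp add: matrix_vector_right_distrib a2)
    also have "\<dots> = stack x 0 \<bullet> (a *v stack y 0)"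
      by (rule inner_symmetric_matrix[OF sym])
    finally show ?thesis .
  qed
  define H where "H = (\<chi> i j. a $ Inl i $ Inl j)"
  have H: "stack x 0 \<bullet> (a *v stack y 0) = x \<bullet> (H *v y)" for x y
    by (simp add: H_def inner_vec_def matrix_vector_mult_def sum_UNIV_Plus)
  have H_nonpos: "x \<bullet> (H *v x) \<le> 0" for x
  proof (rule controllable_no_increasing_storage[OF ctrl])
    show "transpose H = H"
      using sym by (simp add: H_def transpose_def vec_eq_iff)
    show "0 \<le> x \<bullet> (H *v (A *v x + B *v e))" for x e
      using aF[of "stack x e"]
      by (simp only: F stack_matrix_vector_mult beside_matrix_vector_mult form[of x e] H)
  qed
  have zero: "v \<bullet> (a *v v) = 0" for v
  proof -
    obtain x e where v: "v = stack x e"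
      by (rule stack_cases)
    have "v \<bullet> (a *v v) = x \<bullet> (H *v x)"
      unfolding v form[of x e x e] by (rule H)
    with pos[of v] H_nonpos[of x] show ?thesis
      by linarith
  qed
  \<comment> \<open>Polarization: a symmetric form that vanishes on the diagonal vanishes
    everywhere.\<close>
  have "v \<bullet> (a *v w) = 0" for v w
    using zero[of "v + w"] zero[of v] zero[of w] inner_symmetric_matrix[OF sym, of v w]
    by (simp add: matrix_vector_right_distrib inner_add_left inner_add_right)
  then show "a = 0"
    by (metis inner_eq_zero_iff matrix_vector_mult_0 matrix_eq)
qed

section \<open>Feasibility and stabilization from data\<close>

theorem theorem1:
  fixes A :: "real ^ 'n ^ 'n" and B :: "real ^ 'm ^ 'n"
    and lam gam T Ts :: real
    and u :: "real \<Rightarrow> real ^ 'm" and x :: "real \<Rightarrow> real ^ 'n"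
    and zeta :: "real \<Rightarrow> real ^ ('n + 'm)"
    and U :: "real ^ ('k :: {finite, linorder}) ^ 'm"
    and Z Zdot :: "real ^ ('k :: {finite, linorder}) ^ ('n + 'm)"
    and E :: "real ^ ('k :: {finite, linorder}) ^ 'n"
    and F :: "real ^ ('n + 'm) ^ ('n + 'm)" and G :: "real ^ 'm ^ ('n + 'm)"
  assumes "controllable A B"
    and "0 < lam" and "gam \<noteq> 0" and "0 < T" and "Ts = T / real CARD('k)"
    and "input_state_trajectory A B T u x"
    and "caratheodory_solution (\<lambda>t. filter_rhs lam gam (x t) (u t)) T zeta" and "zeta 0 = 0"
    and "U = samples Ts u"
    and "Z = samples Ts zeta"
    and "Zdot = samples Ts (\<lambda>t. filter_rhs lam gam (x t) (u t) (zeta t))"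
    and "E = samples Ts (\<lambda>t. exp (- lam * t) *\<^sub>R x 0)"
    and "F = stack (beside A B) (beside 0 (mat (- lam)))"
    and "G = stack 0 (mat gam)"
  shows "(rank (stack Z U) = CARD('n) + 2 * CARD('m) \<longrightarrow> (\<exists>Q. lmi_solution gam Z Zdot E Q)) \<and>
    (\<forall>Q. lmi_solution gam Z Zdot E Q \<longrightarrow>
      (let K = U ** Q ** matrix_inv (Z ** Q)
       in hurwitz (F + G ** K) \<and>
          origin_globally_exponentially_stable (closed_loop A B lam gam K)))"
proof -
  have data: "Zdot - stack (mat gam) 0 ** E = F ** Z + G ** U"
    unfolding assms(9-14) using assms(4-8) by (intro sampled_dynamics)
  have lmi: "lmi_solution gam Z Zdot E Q \<longleftrightarrow>
      neg_def ((F ** (Z ** Q) + G ** (U ** Q)) + transpose (F ** (Z ** Q) + G ** (U ** Q))) \<and>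
      pos_def (Z ** Q)" for Q
    unfolding lmi_solution_def Let_def data matrix_transpose_mul[symmetric]
    by (auto simp: matrix_add_rdistrib matrix_mul_assoc pos_def_def)
  have feasible: "\<exists>Q. lmi_solution gam Z Zdot E Q" if rank: "rank (stack Z U) = CARD('n) + 2 * CARD('m)"
  proof -
    obtain P Y where PY: "pos_def P" "neg_def ((F ** P + G ** Y) + transpose (F ** P + G ** Y))"
      using extended_plant_LMI[OF assms(1,3,13,14)] by blast
    \<comment> \<open>The rank equals the number of rows, so there is a right inverse R, and Q = R
      (P; Y) realizes the prescribed products Z Q = P and U Q = Y.\<close>
    have "rank (stack Z U) = CARD(('n + 'm) + 'm)"
      using rank by simp
    then have "surj ((*v) (stack Z U))"
      by (simp only: full_rank_surjective)
    then obtain R where R: "stack Z U ** R = mat 1"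
      using matrix_right_invertible_surjective by blast
    have "stack (Z ** (R ** stack P Y)) (U ** (R ** stack P Y)) = stack P Y"
      by (metis R stack_matrix_mult matrix_mul_assoc matrix_mul_lid)
    then have "lmi_solution gam Z Zdot E (R ** stack P Y)"
      using PY by (simp add: lmi)
    then show ?thesis ..
  qed
  have stable: "hurwitz (F + G ** (U ** Q ** matrix_inv (Z ** Q)))"
    "origin_globally_exponentially_stable (closed_loop A B lam gam (U ** Q ** matrix_inv (Z ** Q)))"
    if Q: "lmi_solution gam Z Zdot E Q" for Q
  proof -
    define K where "K = U ** Q ** matrix_inv (Z ** Q)"
    have P: "pos_def (Z ** Q)"
      using Q by (simp add: lmi)
    \<comment> \<open>This identity is the reason for the gain formula: it turns the data expression
      in the LMI into (F + G K) P with P = Z Q.\<close>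
    have "K ** (Z ** Q) = U ** Q"
      unfolding K_def by (metis matrix_mul_assoc matrix_mul_rid pos_def_inverse(1)[OF P])
    then have "(F + G ** K) ** (Z ** Q) = F ** (Z ** Q) + G ** (U ** Q)"
      by (simp add: matrix_add_rdistrib flip: matrix_mul_assoc)
    then have neg: "v \<bullet> (matrix_inv (Z ** Q) *v ((F + G ** K) *v v)) < 0" if "v \<noteq> 0" for v
      using Q P that by (intro Lyapunov_inequality_inverse) (simp_all add: lmi)
    note S = pos_def_inverse(3)[OF P]
    show "hurwitz (F + G ** (U ** Q ** matrix_inv (Z ** Q)))"
      using Lyapunov_hurwitz[OF S neg] by (simp add: K_def)
    show "origin_globally_exponentially_stable (closed_loop A B lam gam (U ** Q ** matrix_inv (Z ** Q)))"
      using closed_loop_exponentially_stable[OF assms(2,3) S _ neg] assms(13,14) by (simp add: K_def)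
  qed
  show ?thesis
    unfolding Let_def using feasible stable by blast
qed

end
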